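(* Let $G$ be a finite connected nonbipartite graph (loops and multiple edges allowed) that is regular of degree $q+1\geq 3$. Then there exist a constant $C_G>0$ and a number $\beta\in[q^{-1/2},1)$, both depending only on $G$, such that for every function $f:V\to\mathbb{R}$ on the vertices of $G$, every geodesic $\gamma=(\ldots,v_{-2},v_{-1},v_0,v_1,v_2,\ldots)$ in the universal cover $\widetilde{G}$ and every integer $r\geq 0$, $$\Big|\frac{1}{|\mathcal{H}_{\gamma,r}(v_0)|}\sum_{v\in\mathcal{H}_{\gamma,r}(v_0)}\tilde f(v)-\frac{1}{|V|}\sum_{v\in V}f(v)\Big|\leq C_G\,\|f\|_2\,\beta^r .$$
   Context: $G$ is a graph with vertex set $V$ and edge set $E$; a loop at a vertex contributes $2$ to its degree. The universal cover $\widetilde{G}$ of $G$ is the tree, with vertex set $\widetilde{V}$ and edge set $\widetilde{E}$, constructed as follows: fix a root vertex of $G$; the vertices of $\widetilde{G}$ are the non-backtracking paths in $G$ starting at the root (each edge, including each loop, may be traversed in two mutually inverse directions, and a path is non-backtracking if no step is immediately followed by its inverse); two such paths are neighbours if they differ by exactly one edge at the end. The projection $\pi:\widetilde{G}\to G$ sends a path to its terminal vertex. The lift of $f:V\to\mathbb{R}$ is $\tilde f=f\circ\pi:\widetilde{V}\to\mathbb{R}$, and $\|f\|_2=\big(\sum_{v\in V}f(v)^2\big)^{1/2}$. Let $\delta$ be the combinatorial distance on $\widetilde{G}$ and $S_r(x)=\{v\in\widetilde{V}:\delta(v,x)=r\}$. A geodesic $\gamma$ on the tree $\widetilde{G}$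 is a bi-infinite non-backtracking path, given by vertices $v_i\in\widetilde{V}$ ($i\in\mathbb{Z}$) with $v_i$ adjacent to $v_{i+1}$ and $v_i\neq v_{i+2}$ for all $i\in\mathbb{Z}$. The Busemann function is $b_{\gamma,v_k}(w)=\lim_{n\to\infty}\big(\delta(w,v_{k+n})-n\big)$ for $w\in\widetilde{V}$. For $k\in\mathbb{Z}$ the horocycle is $H_k=b_{\gamma,v_0}^{-1}(k)\subset\widetilde{V}$. Define the subset of the horocycle $H_0$ $$\mathcal{H}_{\gamma,r}(v_0)=H_0\cap S_r(v_r).$$ *)

theory Defs
  imports "Graph_Theory.Graph_Theory" "HOL-Analysis.L2_Norm"
begin

text \<open>
  An undirected graph with loops and multiple edges is given by its directed edges, as a
  \<^locale>\<open>bidirected_digraph\<close>: \<open>arev\<close> is an involution without fixed points on the arcs that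
  swaps tail and head. The undirected edges are the orbits \<open>{a, arev a}\<close>; a loop consists of two
  mutually inverse arcs with the same tail, so it contributes 2 to \<^const>\<open>out_degree\<close>, which is
  the degree of the undirected graph.
\<close>

definition bipartite :: "('a, 'b) pre_digraph \<Rightarrow> bool" where
  "bipartite G \<longleftrightarrow> (\<exists>A B. verts G = A \<union> B \<and> A \<inter> B = {} \<and>
     (\<forall>a\<in>arcs G. (tail G a \<in> A \<and> head G a \<in> B) \<or> (tail G a \<in> B \<and> head G a \<in> A)))"

definition nonbacktracking :: "('b \<Rightarrow> 'b) \<Rightarrow> 'b list \<Rightarrow> bool" where
  "nonbacktracking arev p \<longleftrightarrow> successively (\<lambda>a b. b \<noteq> arev a) p"

definition cover_verts :: "('a, 'b) pre_digraph \<Rightarrow> ('b \<Rightarrow> 'b) \<Rightarrow> 'a \<Rightarrow> 'b list set" where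
  "cover_verts G arev rt =
     {p. (\<exists>v. pre_digraph.awalk G rt p v) \<and> nonbacktracking arev p}"

definition universal_cover ::
    "('a, 'b) pre_digraph \<Rightarrow> ('b \<Rightarrow> 'b) \<Rightarrow> 'a \<Rightarrow> ('b list, 'b list \<times> 'b list) pre_digraph" where
  "universal_cover G arev rt = with_proj
     \<lparr> pverts = cover_verts G arev rt,
       parcs = {(x, y). x \<in> cover_verts G arev rt \<and> y \<in> cover_verts G arev rt \<and>
                  ((\<exists>a. y = x @ [a]) \<or> (\<exists>a. x = y @ [a]))} \<rparr>"

definition cover_proj :: "('a, 'b) pre_digraph \<Rightarrow> 'a \<Rightarrow> 'b list \<Rightarrow> 'a" where
  "cover_proj G rt x = last (pre_digraph.awalk_verts G rt x)"

definition lift :: "('a, 'b) pre_digraph \<Rightarrow> 'a \<Rightarrow> ('a \<Rightarrow> real) \<Rightarrow> 'b list \<Rightarrow> real" where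
  "lift G rt f = f \<circ> cover_proj G rt"

text \<open>The following notions are used for \<open>T\<close> a universal cover (with both orientations of
  each edge among its arcs); \<^const>\<open>Least\<close> is then over a nonempty set for all vertices.\<close>

definition graph_dist :: "('v, 'e) pre_digraph \<Rightarrow> 'v \<Rightarrow> 'v \<Rightarrow> nat" where
  "graph_dist T x y = (LEAST n. \<exists>p. pre_digraph.awalk T x p y \<and> length p = n)"

definition graph_sphere :: "('v, 'e) pre_digraph \<Rightarrow> nat \<Rightarrow> 'v \<Rightarrow> 'v set" where
  "graph_sphere T r x = {v \<in> verts T. graph_dist T v x = r}"

definition geodesic :: "('v, 'e) pre_digraph \<Rightarrow> (int \<Rightarrow> 'v) \<Rightarrow> bool" where
  "geodesic T \<gamma> \<longleftrightarrow>
     (\<forall>i. \<gamma> i \<in> verts T \<and> (\<gamma> i, \<gamma> (i + 1)) \<in> arcs_ends T \<and> \<gamma> i \<noteq> \<gamma> (i + 2))"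

text \<open>\<open>busemann T \<gamma> k\<close> is the Busemann function normalised at the vertex \<open>\<gamma> k\<close>.\<close>

definition busemann :: "('v, 'e) pre_digraph \<Rightarrow> (int \<Rightarrow> 'v) \<Rightarrow> int \<Rightarrow> 'v \<Rightarrow> real" where
  "busemann T \<gamma> k w = lim (\<lambda>n. real (graph_dist T w (\<gamma> (k + int n))) - real n)"

definition horocycle :: "('v, 'e) pre_digraph \<Rightarrow> (int \<Rightarrow> 'v) \<Rightarrow> int \<Rightarrow> 'v set" where
  "horocycle T \<gamma> k = {w \<in> verts T. busemann T \<gamma> 0 w = of_int k}"

definition horocycle_part :: "('v, 'e) pre_digraph \<Rightarrow> (int \<Rightarrow> 'v) \<Rightarrow> nat \<Rightarrow> 'v set" where
  "horocycle_part T \<gamma> r = horocycle T \<gamma> 0 \<inter> graph_sphere T r (\<gamma> (int r))"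

end

theory Submission
  imports Defs "HOL-Analysis.Function_Topology" "HOL-Library.Sublist"
begin

text \<open>
  Let \<open>P\<close> be the operator on functions of the arcs that averages over the \<open>q\<close> non-backtracking
  continuations of an arc. The vertices of the horocycle part are the endpoints of the
  non-backtracking paths of length \<open>r\<close> that continue the edge from \<open>\<gamma> (r + 1)\<close> to \<open>\<gamma> r\<close>, so the
  average in question is the value of \<open>P\<^sup>r (f \<circ> head)\<close> at one arc of \<open>G\<close>.

  After reversing arcs, \<open>P\<close> acts on the arcs leaving a vertex separately; there it fixes constants and
  is \<open>- 1 / q\<close> on functions of sum zero. Hence \<open>P\<close> preserves the mean, does not increase the
  \<open>\<ell>\<^sup>2\<close> norm, and preserves the norm of \<open>g\<close> only if \<open>g\<close> depends on the tail of the arc alone. If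
  \<open>P\<^sup>2\<close> preserves the norm of \<open>g\<close>, then \<open>g = h \<circ> tail\<close> where \<open>h\<close> is constant on the neighbours of
  each vertex, so \<open>h\<close> is constant because \<open>G\<close> is connected and not bipartite. By compactness
  \<open>P\<^sup>2\<close> contracts the functions of mean zero by a uniform factor.
\<close>

section \<open>Contraction of the non-backtracking average\<close>

lemma sum_power2_diff:
  fixes g :: "'b \<Rightarrow> real"
  shows "(\<Sum>a\<in>A. (g a - c)\<^sup>2) = (\<Sum>a\<in>A. (g a)\<^sup>2) - 2 * c * (\<Sum>a\<in>A. g a) + real (card A) * c\<^sup>2"
proof -
  have "(g a - c)\<^sup>2 = (g a)\<^sup>2 - 2 * c * g a + c\<^sup>2" for a
    by (simp add: power2_diff)
  then show ?thesis
    by (simp add: sum.distrib sum_subtractf sum_distrib_left)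
qed

text \<open>Subtracting the mean removes \<open>s\<^sup>2 / n\<close> from the sum of squares, where
  \<open>s\<close> is the sum over \<open>n\<close> points.\<close>

lemma sum_power2_diff_mean_le:
  fixes f :: "'a \<Rightarrow> real"
  shows "(\<Sum>v\<in>A. (f v - (\<Sum>v\<in>A. f v) / real (card A))\<^sup>2) \<le> (\<Sum>v\<in>A. (f v)\<^sup>2)"
proof (cases "card A = 0")
  case False
  define s n where "s = (\<Sum>v\<in>A. f v)" and "n = real (card A)"
  have "- 2 * (s / n) * s + n * (s / n)\<^sup>2 = - (s\<^sup>2 / n)"
    using False by (simp add: n_def power2_eq_square)
  moreover have "s\<^sup>2 / n \<ge> 0" by (simp add: n_def)
  ultimately show ?thesis
    unfolding sum_power2_diff s_def[symmetric] n_def[symmetric] by linarith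
qed simp

locale regular_nonbipartite_graph = bidirected_digraph G arev + fin_digraph G
  for G :: "('a, 'b) pre_digraph" and arev :: "'b \<Rightarrow> 'b" +
  fixes q :: nat
  assumes conn: "Digraph_Component.connected G"
    and nonbip: "\<not> bipartite G"
    and q_ge_2: "q \<ge> 2"
    and regular: "v \<in> verts G \<Longrightarrow> out_degree G v = q + 1"
begin

definition star_sum :: "('b \<Rightarrow> real) \<Rightarrow> 'a \<Rightarrow> real" where
  "star_sum g v = (\<Sum>a\<in>out_arcs G v. g a)"

definition star_mean :: "('b \<Rightarrow> real) \<Rightarrow> 'a \<Rightarrow> real" where
  "star_mean g v = star_sum g v / (real q + 1)"

text \<open>The operator \<open>P\<close>. For an arc \<open>e\<close>, deleting the backtracking
  arc leaves \<open>q\<close> terms, hence the divisor.\<close>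

definition nbt :: "('b \<Rightarrow> real) \<Rightarrow> 'b \<Rightarrow> real" where
  "nbt g e = (\<Sum>a\<in>out_arcs G (head G e) - {arev e}. g a) / real q"

text \<open>The squared norm. It ignores values off \<open>arcs G\<close>, so functions on the whole
  type can stand for functions on arcs.\<close>

definition energy :: "('b \<Rightarrow> real) \<Rightarrow> real" where
  "energy g = (\<Sum>a\<in>arcs G. (g a)\<^sup>2)"

section \<open>Sums over arcs and the action of \<open>nbt\<close> on stars\<close>

lemma card_out_arcs: "v \<in> verts G \<Longrightarrow> card (out_arcs G v) = q + 1"
  using regular by (simp add: out_degree_def)

lemma sum_arcs_by_tail:
  fixes h :: "'b \<Rightarrow> real"
  shows "(\<Sum>a\<in>arcs G. h a) = (\<Sum>v\<in>verts G. \<Sum>a\<in>out_arcs G v. h a)"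
proof -
  have "tail G ` arcs G \<subseteq> verts G" by auto
  from sum.group[OF finite_arcs finite_verts this, of h] show ?thesis
    by (simp add: out_arcs_def)
qed

lemma sum_arcs_tail:
  fixes h :: "'a \<Rightarrow> real"
  shows "(\<Sum>a\<in>arcs G. h (tail G a)) = (real q + 1) * (\<Sum>v\<in>verts G. h v)"
proof -
  have "(\<Sum>a\<in>out_arcs G v. h (tail G a)) = (real q + 1) * h v" if "v \<in> verts G" for v
  proof -
    have "(\<Sum>a\<in>out_arcs G v. h (tail G a)) = (\<Sum>a\<in>out_arcs G v. h v)"
      by (rule sum.cong) auto
    then show ?thesis using card_out_arcs[OF that] by simp
  qed
  then show ?thesis
    unfolding sum_arcs_by_tail sum_distrib_left by (intro sum.cong) auto
qed

lemma sum_arcs_arev: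
  fixes h :: "'b \<Rightarrow> real"
  shows "(\<Sum>a\<in>arcs G. h (arev a)) = (\<Sum>a\<in>arcs G. h a)"
  by (rule sum.reindex_bij_betw[OF permutes_imp_bij[OF arev_permutes_arcs]])

lemma sum_arcs_head:
  fixes h :: "'a \<Rightarrow> real"
  shows "(\<Sum>a\<in>arcs G. h (head G a)) = (real q + 1) * (\<Sum>v\<in>verts G. h v)"
proof -
  have "(\<Sum>a\<in>arcs G. h (head G a)) = (\<Sum>a\<in>arcs G. h (tail G (arev a)))"
    by (rule sum.cong) auto
  then show ?thesis
    using sum_arcs_arev[of "\<lambda>a. h (tail G a)"] sum_arcs_tail[of h] by simp
qed

text \<open>The continuations of \<open>arev a\<close> are the other arcs with the tail of
  \<open>a\<close>. So after reversal, which permutes the arcs, the operator splits into one block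
  for each vertex.\<close>

lemma nbt_arev:
  assumes "a \<in> arcs G"
  shows "nbt g (arev a) = (star_sum g (tail G a) - g a) / real q"
proof -
  have "a \<in> out_arcs G (tail G a)" "finite (out_arcs G (tail G a))" using assms by auto
  then show ?thesis
    using assms by (simp add: nbt_def star_sum_def sum_diff1)
qed

lemma sum_star_sum: "(\<Sum>v\<in>verts G. star_sum g v) = (\<Sum>a\<in>arcs G. g a)"
  by (simp add: star_sum_def sum_arcs_by_tail)

text \<open>After reversal, each \<open>g a\<close> is counted with weight \<open>1 / q\<close> by
  each of the \<open>q\<close> other arcs of its star.\<close>

lemma sum_nbt: "(\<Sum>e\<in>arcs G. nbt g e) = (\<Sum>e\<in>arcs G. g e)"
proof -
  have "(\<Sum>e\<in>arcs G. nbt g e) = (\<Sum>a\<in>arcs G. (star_sum g (tail G a) - g a) / real q)"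
    by (subst sum_arcs_arev[symmetric]) (simp add: nbt_arev cong: sum.cong)
  also have "\<dots> = ((\<Sum>a\<in>arcs G. star_sum g (tail G a)) - (\<Sum>a\<in>arcs G. g a)) / real q"
    by (simp add: sum_subtractf sum_divide_distrib diff_divide_distrib)
  also have "\<dots> = (\<Sum>a\<in>arcs G. g a)"
    using q_ge_2 by (simp add: sum_arcs_tail sum_star_sum field_simps)
  finally show ?thesis .
qed

text \<open>The star block fixes constants and multiplies functions of sum zero by
  \<open>- 1 / q\<close>. Only the deviation from the star mean, orthogonal to constants, loses
  energy, and it keeps the fraction \<open>1 / q\<^sup>2\<close>.\<close>

lemma energy_star:
  assumes "v \<in> verts G"
  shows "(\<Sum>a\<in>out_arcs G v. ((star_sum g v - g a) / real q)\<^sup>2)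
    = (\<Sum>a\<in>out_arcs G v. (g a)\<^sup>2)
      - (1 - 1 / (real q)\<^sup>2) * (\<Sum>a\<in>out_arcs G v. (g a - star_mean g v)\<^sup>2)"
proof -
  define s N where "s = star_sum g v" and "N = (\<Sum>a\<in>out_arcs G v. (g a)\<^sup>2)"
  have c: "real (card (out_arcs G v)) = real q + 1"
    using card_out_arcs[OF assms] by simp
  have s: "(\<Sum>a\<in>out_arcs G v. g a) = s" by (simp add: s_def star_sum_def)
  define t where "t = real q"
  have t: "t > 0" "t + 1 \<noteq> 0" using q_ge_2 by (auto simp: t_def)
  have "(\<Sum>a\<in>out_arcs G v. ((s - g a) / real q)\<^sup>2) = (\<Sum>a\<in>out_arcs G v. (g a - s)\<^sup>2) / (real q)\<^sup>2"
    by (simp add: power_divide power2_commute sum_divide_distrib)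
  \<comment> \<open>The numerator expands to
    \<open>N - 2 * s\<^sup>2 + (q + 1) * s\<^sup>2\<close>.\<close>
  also have "\<dots> = (N + (real q - 1) * s\<^sup>2) / (real q)\<^sup>2"
    by (simp only: sum_power2_diff c s N_def[symmetric]) (simp add: power2_eq_square algebra_simps)
  finally have l: "(\<Sum>a\<in>out_arcs G v. ((s - g a) / real q)\<^sup>2) = \<dots>" .
  have m: "(\<Sum>a\<in>out_arcs G v. (g a - star_mean g v)\<^sup>2) = N - s\<^sup>2 / (real q + 1)"
  proof -
    have "N - 2 * (s / (t + 1)) * s + (t + 1) * (s / (t + 1))\<^sup>2 = N - s\<^sup>2 / (t + 1)"
      using t by (simp add: power2_eq_square)
    then show ?thesis
      by (simp only: sum_power2_diff c s N_def[symmetric] star_mean_def s_def[symmetric] t_def)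
  qed
  have "1 - 1 / t\<^sup>2 = (t - 1) * (t + 1) / t\<^sup>2"
    using t by (simp add: power2_eq_square field_simps)
  then have "(1 - 1 / t\<^sup>2) * (s\<^sup>2 / (t + 1)) = (t - 1) * s\<^sup>2 / t\<^sup>2"
    using t by simp
  then have "(N + (t - 1) * s\<^sup>2) / t\<^sup>2 = N - (1 - 1 / t\<^sup>2) * (N - s\<^sup>2 / (t + 1))"
    by (simp add: right_diff_distrib left_diff_distrib add_divide_distrib)
  then show ?thesis using l m by (simp add: s_def N_def t_def)
qed

text \<open>Summing the star identity over all vertices gives the exact loss of energy, which yields
  both monotonicity and the equality case.\<close>

lemma energy_nbt:
  "energy (nbt g) = energy g - (1 - 1 / (real q)\<^sup>2) * (\<Sum>a\<in>arcs G. (g a - star_mean g (tail G a))\<^sup>2)"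
proof -
  have "energy (nbt g) = (\<Sum>a\<in>arcs G. ((star_sum g (tail G a) - g a) / real q)\<^sup>2)"
    unfolding energy_def
    by (subst sum_arcs_arev[symmetric]) (simp add: nbt_arev cong: sum.cong)
  also have "\<dots> = (\<Sum>v\<in>verts G. \<Sum>a\<in>out_arcs G v. ((star_sum g v - g a) / real q)\<^sup>2)"
    by (simp add: sum_arcs_by_tail)
  also have "\<dots> = (\<Sum>v\<in>verts G. (\<Sum>a\<in>out_arcs G v. (g a)\<^sup>2)
      - (1 - 1 / (real q)\<^sup>2) * (\<Sum>a\<in>out_arcs G v. (g a - star_mean g v)\<^sup>2))"
    by (rule sum.cong[OF refl energy_star])
  also have "\<dots> = energy g - (1 - 1 / (real q)\<^sup>2) * (\<Sum>a\<in>arcs G. (g a - star_mean g (tail G a))\<^sup>2)"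
    by (simp add: energy_def sum_arcs_by_tail sum_subtractf sum_distrib_left)
  finally show ?thesis .
qed

lemma energy_nonneg: "energy g \<ge> 0"
  by (simp add: energy_def sum_nonneg)

lemma energy_factor_pos: "1 - 1 / (real q)\<^sup>2 > 0"
  using q_ge_2 by (simp add: divide_simps one_less_power)

lemma energy_nbt_le: "energy (nbt g) \<le> energy g"
  using energy_factor_pos by (simp add: energy_nbt sum_nonneg)

lemma energy_nbt_eqD:
  assumes "energy (nbt g) = energy g" "a \<in> arcs G"
  shows "g a = star_mean g (tail G a)"
proof -
  have "(\<Sum>a\<in>arcs G. (g a - star_mean g (tail G a))\<^sup>2) = 0"
  proof -
    have "(1 - 1 / (real q)\<^sup>2) * (\<Sum>a\<in>arcs G. (g a - star_mean g (tail G a))\<^sup>2) = 0"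
      using assms(1) unfolding energy_nbt by linarith
    then show ?thesis using energy_factor_pos mult_eq_0_iff less_irrefl by metis
  qed
  then have "(g a - star_mean g (tail G a))\<^sup>2 = 0"
    using sum_nonneg_0[OF finite_arcs _ _ assms(2), of "\<lambda>a. (g a - star_mean g (tail G a))\<^sup>2"] by simp
  then show ?thesis by simp
qed

section \<open>Connectedness and the absence of a bipartition\<close>

text \<open>Closure under heads suffices: an arc followed backwards is its reverse followed
  forwards, so \<open>S\<close> is also closed along the symmetric relation that defines
  connectedness.\<close>

lemma verts_closed:
  assumes S: "v \<in> S" "v \<in> verts G"
    and cl: "\<And>a. a \<in> arcs G \<Longrightarrow> tail G a \<in> S \<Longrightarrow> head G a \<in> S"
  shows "verts G \<subseteq> S"
proof
  fix u assume u: "u \<in> verts G"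
  have cl': "\<And>x y. (x, y) \<in> (arcs_ends G)\<^sup>s \<Longrightarrow> x \<in> S \<Longrightarrow> y \<in> S"
  proof -
    fix x y assume xy: "(x, y) \<in> (arcs_ends G)\<^sup>s" and x: "x \<in> S"
    then consider a where "a \<in> arcs G" "x = tail G a" "y = head G a"
      | a where "a \<in> arcs G" "y = tail G a" "x = head G a"
      by (auto simp: symcl_def arcs_ends_conv)
    then show "y \<in> S"
    proof cases
      case 1 then show ?thesis using cl x by simp
    next
      case (2 a) then show ?thesis using cl[of "arev a"] x by simp
    qed
  qed
  have "(v, u) \<in> rtrancl_on (verts G) ((arcs_ends G)\<^sup>s)"
    using conn u S(2) by (auto simp: connected_conv)
  then show "u \<in> S"
    by (induction rule: rtrancl_on_induct) (auto intro: S cl')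
qed

text \<open>If \<open>m\<close> takes a single value on the neighbours of each vertex, its difference from that value
  changes sign along arcs, so it vanishes unless its sign is a bipartition.\<close>

lemma constant_if_locally_determined:
  fixes m k :: "'a \<Rightarrow> real"
  assumes mk: "\<And>a. a \<in> arcs G \<Longrightarrow> m (head G a) = k (tail G a)"
    and "v \<in> verts G" "u \<in> verts G"
  shows "m u = m v"
proof -
  have km: "k (head G a) = m (tail G a)" if "a \<in> arcs G" for a
    using mk[of "arev a"] that by simp
  define d where "d = m v - k v"
  \<comment> \<open>Each arc exchanges the values of \<open>m\<close> and \<open>k\<close>, so every
    vertex carries the pair found at \<open>v\<close> or its swap.\<close>
  have *: "verts G \<subseteq> {x. m x = m v \<and> k x = k v \<or> m x = k v \<and> k x = m v}"
    by (rule verts_closed[OF _ assms(2)]) (auto simp: mk km)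
  have "d = 0"
  proof (rule ccontr)
    assume d: "d \<noteq> 0"
    define A B where "A = {x \<in> verts G. m x = m v \<and> k x = k v}"
      and "B = {x \<in> verts G. m x = k v \<and> k x = m v}"
    have "verts G = A \<union> B" "A \<inter> B = {}"
      using * d by (auto simp: A_def B_def d_def)
    moreover have "\<forall>a\<in>arcs G. (tail G a \<in> A \<and> head G a \<in> B) \<or> (tail G a \<in> B \<and> head G a \<in> A)"
    proof
      fix a assume that: "a \<in> arcs G"
      have "tail G a \<in> verts G" "head G a \<in> verts G" using that by auto
      with subsetD[OF *, of "tail G a"] mk[OF that] km[OF that]
      show "(tail G a \<in> A \<and> head G a \<in> B) \<or> (tail G a \<in> B \<and> head G a \<in> A)"
        unfolding A_def B_def by auto
    qed
    ultimately have "bipartite G"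
      unfolding bipartite_def by (rule_tac exI[of _ A], rule_tac exI[of _ B]) simp
    then show False using nonbip by simp
  qed
  then have "m v = k v" by (simp add: d_def)
  then show ?thesis using subsetD[OF * assms(3)] by auto
qed

text \<open>One step loses nothing on functions of the tail, so two steps are compared. If neither
  loses energy, \<open>g\<close> is a function \<open>m\<close> of the tail and
  \<open>nbt g\<close>, which is \<open>m\<close> of the head, also depends on the tail alone. Then
  \<open>m\<close> is constant, and sum zero forces \<open>g\<close> to vanish.\<close>

lemma energy_nbt_nbt_less:
  assumes "(\<Sum>a\<in>arcs G. g a) = 0" "energy g > 0"
  shows "energy (nbt (nbt g)) < energy g"
proof (rule ccontr)
  assume "\<not> ?thesis"
  then have e1: "energy (nbt g) = energy g" and e2: "energy (nbt (nbt g)) = energy (nbt g)"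
    using energy_nbt_le[of g] energy_nbt_le[of "nbt g"] by linarith+
  define m where "m = star_mean g"
  have ga: "g a = m (tail G a)" if "a \<in> arcs G" for a
    using energy_nbt_eqD[OF e1 that] by (simp add: m_def)
  have "nbt g e = m (head G e)" if e: "e \<in> arcs G" for e
  proof -
    have "arev e \<in> out_arcs G (head G e)" "head G e \<in> verts G" using e by auto
    moreover have "(\<Sum>a\<in>out_arcs G (head G e) - {arev e}. g a)
        = (\<Sum>a\<in>out_arcs G (head G e) - {arev e}. m (head G e))"
      by (rule sum.cong) (auto simp: ga)
    ultimately show ?thesis
      using q_ge_2 by (simp add: nbt_def card_out_arcs)
  qed
  then have "m (head G e) = star_mean (nbt g) (tail G e)" if "e \<in> arcs G" for e
    using energy_nbt_eqD[OF e2 that] that by simp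
  note const = constant_if_locally_determined[of m, OF this]
  have "arcs G \<noteq> {}" using assms(2) by (auto simp: energy_def)
  then obtain a0 where a0: "a0 \<in> arcs G" by blast
  define c where "c = g a0"
  have gc: "g a = c" if "a \<in> arcs G" for a
    unfolding c_def using ga[OF that] ga[OF a0] const[of "tail G a0" "tail G a"] that a0 by simp
  then have "(\<Sum>a\<in>arcs G. g a) = real (card (arcs G)) * c" by simp
  then have "c = 0" using assms(1) a0 by auto
  then show False using assms(2) gc by (simp add: energy_def)
qed

section \<open>Uniform contraction by compactness\<close>

text \<open>Compactness is taken in the product topology on all functions. Vanishing off the arcs
  places the set in a product of compact intervals and points; the other conditions are closed, as
  they involve finitely many coordinates.\<close>

lemma compact_unit_energy:
  "compact {g :: 'b \<Rightarrow> real. (\<forall>a. a \<notin> arcs G \<longrightarrow> g a = 0) \<and> (\<Sum>a\<in>arcs G. g a) = 0 \<and> energy g = 1}"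
    (is "compact ?K")
proof -
  define S :: "'b \<Rightarrow> real set" where "S a = (if a \<in> arcs G then {-1..1} else {0})" for a
  have "compactin (product_topology (\<lambda>_. euclidean) UNIV) (Pi\<^sub>E UNIV S)"
    by (subst compactin_PiE) (auto simp: S_def)
  then have "compact (Pi\<^sub>E UNIV S)"
    by (simp add: euclidean_product_topology)
  moreover have "closed {g :: 'b \<Rightarrow> real. (\<Sum>a\<in>arcs G. g a) = 0 \<and> energy g = 1}"
    unfolding energy_def
    by (intro closed_Collect_conj closed_Collect_eq continuous_intros) auto
  ultimately have "compact (Pi\<^sub>E UNIV S \<inter> {g. (\<Sum>a\<in>arcs G. g a) = 0 \<and> energy g = 1})"
    by (rule compact_Int_closed)
  moreover have "?K = Pi\<^sub>E UNIV S \<inter> {g. (\<Sum>a\<in>arcs G. g a) = 0 \<and> energy g = 1}"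
  proof -
    have "g a \<in> {-1..1}" if "energy g = 1" "a \<in> arcs G" for g a
    proof -
      have "(g a)\<^sup>2 \<le> energy g"
        unfolding energy_def using that(2) by (intro member_le_sum) auto
      then show ?thesis using that(1) by (simp add: abs_square_le_1 abs_le_iff)
    qed
    then show ?thesis by (fastforce simp: S_def PiE_iff split: if_splits)
  qed
  ultimately show ?thesis by simp
qed

lemma nbt_cmult: "nbt (\<lambda>a. c * g a) = (\<lambda>e. c * nbt g e)"
  by (simp add: nbt_def fun_eq_iff sum_distrib_left)

lemma energy_cmult: "energy (\<lambda>a. c * g a) = c\<^sup>2 * energy g"
  by (simp add: energy_def power_mult_distrib sum_distrib_left)

lemma nbt_cong:
  assumes "\<And>a. a \<in> arcs G \<Longrightarrow> g a = h a"
  shows "nbt g = nbt h"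
proof
  fix e
  have "(\<Sum>a\<in>out_arcs G (head G e) - {arev e}. g a) = (\<Sum>a\<in>out_arcs G (head G e) - {arev e}. h a)"
    using assms by (intro sum.cong) auto
  then show "nbt g e = nbt h e" by (simp add: nbt_def)
qed

lemma energy_cong: "(\<And>a. a \<in> arcs G \<Longrightarrow> g a = h a) \<Longrightarrow> energy g = energy h"
  by (simp add: energy_def)

text \<open>The energy after two steps is continuous and attains its maximum on the compact unit
  sphere. The strict inequality puts that maximum below 1, and homogeneity extends the bound to all
  functions of sum zero.\<close>

lemma energy_contraction:
  obtains M where "0 \<le> M" "M < 1"
    "\<And>g. (\<Sum>a\<in>arcs G. g a) = 0 \<Longrightarrow> energy (nbt (nbt g)) \<le> M * energy g"
proof -
  define K where
    "K = {g :: 'b \<Rightarrow> real. (\<forall>a. a \<notin> arcs G \<longrightarrow> g a = 0) \<and> (\<Sum>a\<in>arcs G. g a) = 0 \<and> energy g = 1}"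
  have cont: "continuous_on K (\<lambda>g. energy (nbt (nbt g)))"
    unfolding energy_def nbt_def divide_inverse
    by (intro continuous_intros continuous_on_subset[OF continuous_on_product_coordinates]) auto
  have "\<exists>M. 0 \<le> M \<and> M < 1 \<and> (\<forall>g\<in>K. energy (nbt (nbt g)) \<le> M)"
  proof (cases "K = {}")
    case True then show ?thesis by (auto intro: exI[of _ 0])
  next
    case False
    then obtain h where h: "h \<in> K" "\<forall>g\<in>K. energy (nbt (nbt g)) \<le> energy (nbt (nbt h))"
      using continuous_attains_sup[OF compact_unit_energy[folded K_def] _ cont] by blast
    then show ?thesis using energy_nbt_nbt_less[of h] energy_nonneg
      by (intro exI[of _ "energy (nbt (nbt h))"]) (auto simp: K_def)
  qed
  then obtain M where M: "0 \<le> M" "M < 1" "\<And>g. g \<in> K \<Longrightarrow> energy (nbt (nbt g)) \<le> M" by blast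
  show thesis
  proof (rule that[OF M(1,2)])
    fix g :: "'b \<Rightarrow> real" assume s: "(\<Sum>a\<in>arcs G. g a) = 0"
    show "energy (nbt (nbt g)) \<le> M * energy g"
    proof (cases "energy g = 0")
      case True
      then show ?thesis using energy_nbt_le[of g] energy_nbt_le[of "nbt g"] by simp
    next
      case False
      \<comment> \<open>Scaling to unit energy and cutting off outside the arcs moves
        \<open>g\<close> into \<open>K\<close>; the cut-off changes neither \<open>nbt\<close> nor
        the energy.\<close>
      define c where "c = 1 / sqrt (energy g)"
      define h where "h a = (if a \<in> arcs G then c * g a else 0)" for a
      have c2: "c\<^sup>2 * energy g = 1"
        using False energy_nonneg[of g] by (simp add: c_def power_divide)
      have "energy h = 1"
        using c2 energy_cong[of h "\<lambda>a. c * g a"] by (simp add: h_def energy_cmult)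
      moreover have "(\<Sum>a\<in>arcs G. h a) = c * (\<Sum>a\<in>arcs G. g a)"
        by (simp add: h_def sum_distrib_left)
      ultimately have "h \<in> K" using s by (simp add: K_def h_def)
      moreover have "nbt h = nbt (\<lambda>a. c * g a)"
        by (rule nbt_cong) (simp add: h_def)
      ultimately have "c\<^sup>2 * energy (nbt (nbt g)) \<le> M"
        using M(3)[of h] by (simp add: nbt_cmult energy_cmult)
      then have "energy g * (c\<^sup>2 * energy (nbt (nbt g))) \<le> energy g * M"
        using energy_nonneg[of g] by (rule mult_left_mono)
      moreover have "energy g * (c\<^sup>2 * energy (nbt (nbt g))) = (c\<^sup>2 * energy g) * energy (nbt (nbt g))"
        by simp
      ultimately show ?thesis using c2 by (simp add: mult.commute)
    qed
  qed
qed

text \<open>Two steps gain \<open>\<beta> ^ 4\<close> in energy, so the induction goes down by two.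
  The divisor \<open>\<beta>\<^sup>2\<close> pays for odd \<open>r\<close>, where the one remaining
  step is only known not to increase the energy.\<close>

lemma energy_nbt_decay:
  assumes "0 < \<beta>" "\<beta> \<le> 1" "M \<le> \<beta> ^ 4"
    and M: "\<And>g. (\<Sum>a\<in>arcs G. g a) = 0 \<Longrightarrow> energy (nbt (nbt g)) \<le> M * energy g"
    and "(\<Sum>a\<in>arcs G. g a) = 0"
  shows "energy ((nbt ^^ r) g) \<le> energy g / \<beta>\<^sup>2 * (\<beta> ^ r)\<^sup>2"
  using assms(5)
proof (induction r arbitrary: g rule: less_induct)
  case (less r)
  consider "r = 0" | "r = 1" | s where "r = s + 2"
    using le_Suc_ex[of 2 r] by (cases "r < 2") (auto simp: less_2_cases_iff add.commute)
  then show ?case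
  proof cases
    case 1
    have "\<beta>\<^sup>2 \<le> 1" using assms(1,2) by (simp add: power_le_one)
    then have "energy g * \<beta>\<^sup>2 \<le> energy g" using energy_nonneg[of g] by (simp add: mult_left_le)
    then show ?thesis using 1 assms(1) by (simp add: field_simps)
  next
    case 2
    then show ?thesis using energy_nbt_le[of g] assms(1) by simp
  next
    case (3 s)
    have "energy ((nbt ^^ r) g) = energy ((nbt ^^ s) (nbt (nbt g)))"
      by (simp add: 3 funpow_Suc_right del: funpow.simps)
    also have "\<dots> \<le> energy (nbt (nbt g)) / \<beta>\<^sup>2 * (\<beta> ^ s)\<^sup>2"
      using less.IH[of s "nbt (nbt g)"] less.prems 3 by (simp add: sum_nbt)
    also have "\<dots> \<le> (\<beta> ^ 4 * energy g) / \<beta>\<^sup>2 * (\<beta> ^ s)\<^sup>2"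
    proof -
      have "energy (nbt (nbt g)) \<le> \<beta> ^ 4 * energy g"
        using M[OF less.prems] mult_right_mono[OF assms(3) energy_nonneg[of g]] by linarith
      then show ?thesis by (intro mult_right_mono divide_right_mono) auto
    qed
    also have "\<dots> = energy g / \<beta>\<^sup>2 * (\<beta> ^ r)\<^sup>2"
      using assms(1) by (simp add: 3 power_add power_mult_distrib power2_eq_square power4_eq_xxxx)
    finally show ?thesis .
  qed
qed

end

section \<open>Distances in the universal cover\<close>

text \<open>The tree metric on words, \<open>|x| + |y|\<close> minus twice the length of the longest common prefix.\<close>

fun word_dist :: "'b list \<Rightarrow> 'b list \<Rightarrow> nat" where
  "word_dist [] ys = length ys"
| "word_dist (x # xs) [] = Suc (length xs)"
| "word_dist (x # xs) (y # ys) = (if x = y then word_dist xs ys else 2 + length xs + length ys)"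

lemma word_dist_Nil2: "word_dist x [] = length x"
  by (cases x) auto

lemma word_dist_eq_0_iff [simp]: "word_dist x y = 0 \<longleftrightarrow> x = y"
  by (induction x y rule: word_dist.induct) auto

lemma word_dist_refl [simp]: "word_dist x x = 0"
  by simp

lemma word_dist_commute: "word_dist x y = word_dist y x"
  by (induction x y rule: word_dist.induct) (auto simp: word_dist_Nil2)

lemma word_dist_snoc_prefix: "prefix (y @ [a]) x \<Longrightarrow> word_dist x y = Suc (word_dist x (y @ [a]))"
  by (induction x y rule: word_dist.induct) (auto simp: word_dist_Nil2)

lemma word_dist_snoc_not_prefix: "\<not> prefix (y @ [a]) x \<Longrightarrow> word_dist x (y @ [a]) = Suc (word_dist x y)"
  by (induction x y rule: word_dist.induct) auto

text \<open>Adjacency in the cover without membership in its vertex set, so that the tree arguments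
  apply to arbitrary words.\<close>

definition word_adj :: "'b list \<Rightarrow> 'b list \<Rightarrow> bool" where
  "word_adj x y \<longleftrightarrow> (\<exists>a. y = x @ [a]) \<or> (\<exists>a. x = y @ [a])"

lemma word_adj_commute: "word_adj x y \<longleftrightarrow> word_adj y x"
  by (auto simp: word_adj_def)

lemma word_dist_adj:
  assumes "word_adj y z"
  shows "word_dist x z = Suc (word_dist x y) \<or> word_dist x y = Suc (word_dist x z)"
  using assms word_dist_snoc_prefix word_dist_snoc_not_prefix unfolding word_adj_def by metis

lemma word_dist_closer_iff:
  "word_adj y z \<and> word_dist x y = Suc (word_dist x z) \<longleftrightarrow>
    (\<exists>a. z = y @ [a] \<and> prefix z x) \<or> (\<exists>a. y = z @ [a] \<and> \<not> prefix y x)"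
    (is "?l \<longleftrightarrow> ?r")
proof
  assume l: ?l
  then consider a where "z = y @ [a]" | a where "y = z @ [a]" by (auto simp: word_adj_def)
  then show ?r
  proof cases
    case (1 a) then show ?thesis using l word_dist_snoc_not_prefix[of y a x] by auto
  next
    case (2 a) then show ?thesis using l word_dist_snoc_prefix[of z a x] by auto
  qed
next
  assume ?r
  then show ?l
    using word_dist_snoc_prefix[of y _ x] word_dist_snoc_not_prefix[of z _ x]
    by (auto simp: word_adj_def)
qed

text \<open>The tree property: the only neighbour of \<open>y\<close> nearer to \<open>x\<close> is
  the next prefix of \<open>x\<close> if \<open>y\<close> is a prefix of \<open>x\<close>, and
  otherwise \<open>y\<close> without its last letter.\<close>

lemma word_dist_closer_unique:
  assumes "word_adj y z" "word_dist x y = Suc (word_dist x z)"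
    and "word_adj y z'" "word_dist x y = Suc (word_dist x z')"
  shows "z = z'"
proof -
  have "(\<exists>a. z = y @ [a] \<and> prefix z x) \<or> (\<exists>a. y = z @ [a] \<and> \<not> prefix y x)"
    and "(\<exists>a. z' = y @ [a] \<and> prefix z' x) \<or> (\<exists>a. y = z' @ [a] \<and> \<not> prefix y x)"
    using assms word_dist_closer_iff by blast+
  then show ?thesis by (auto dest: append_prefixD) (auto simp: prefix_def)
qed

text \<open>The unique neighbour of \<open>z\<close> nearer to \<open>x\<close> is \<open>y\<close>,
  so a path that has begun to move away and does not backtrack keeps moving away.\<close>

lemma word_dist_away:
  assumes "word_adj y z" "word_adj z z'" "z' \<noteq> y" "word_dist x z = Suc (word_dist x y)"
  shows "word_dist x z' = Suc (word_dist x z)"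
  using assms word_dist_adj[of z z' x] word_dist_closer_unique[of z z' x y] word_adj_commute[of y z]
  by auto

section \<open>The universal cover as a tree of words\<close>

locale rooted_bidirected_digraph = bidirected_digraph G arev
  for G :: "('a, 'b) pre_digraph" and arev :: "'b \<Rightarrow> 'b" +
  fixes rt :: 'a
  assumes root_in_verts: "rt \<in> verts G"
begin

abbreviation "T \<equiv> universal_cover G arev rt"
abbreviation "V \<equiv> cover_verts G arev rt"
abbreviation "proj \<equiv> cover_proj G rt"

lemma Nil_in_V: "[] \<in> V"
  using root_in_verts by (auto simp: cover_verts_def nonbacktracking_def awalk_Nil_iff)

lemma proj_snoc: "proj (x @ [a]) = head G a"
  by (simp add: cover_proj_def awalk_verts_conv)

lemma snoc_in_V_iff:
  "x @ [a] \<in> V \<longleftrightarrow> x \<in> V \<and> a \<in> arcs G \<and> tail G a = proj x \<and> (x \<noteq> [] \<longrightarrow> a \<noteq> arev (last x))"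
proof -
  have "(\<exists>v. awalk rt (x @ [a]) v) \<longleftrightarrow> (\<exists>v. awalk rt x v) \<and> a \<in> arcs G \<and> tail G a = proj x"
  proof -
    have "awalk rt (x @ [a]) v \<longleftrightarrow> awalk rt x (proj x) \<and> awalk (proj x) [a] v" for v
      by (simp add: cover_proj_def)
    moreover have "(\<exists>v. awalk rt x v) \<longleftrightarrow> awalk rt x (proj x)"
      by (auto simp: cover_proj_def)
    moreover have "awalk (proj x) [a] v \<longleftrightarrow>
        proj x \<in> verts G \<and> a \<in> arcs G \<and> tail G a = proj x \<and> head G a = v" for v
      by (auto simp: awalk_def)
    moreover have "awalk rt x (proj x) \<Longrightarrow> proj x \<in> verts G"
      by (rule awalk_last_in_verts)
    ultimately show ?thesis by auto
  qed
  moreover have "nonbacktracking arev (x @ [a]) \<longleftrightarrow>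
      nonbacktracking arev x \<and> (x \<noteq> [] \<longrightarrow> a \<noteq> arev (last x))"
    by (auto simp: nonbacktracking_def successively_append_iff)
  ultimately show ?thesis
    unfolding cover_verts_def mem_Collect_eq by blast
qed

lemma prefix_in_V: "x @ y \<in> V \<Longrightarrow> x \<in> V"
  by (induction y rule: rev_induct) (auto simp: snoc_in_V_iff simp flip: append_assoc)

lemma arcs_T: "arcs T = {(x, y). x \<in> V \<and> y \<in> V \<and> word_adj x y}"
  by (simp add: universal_cover_def word_adj_def)

lemma arcs_ends_T: "arcs_ends T = {(x, y). x \<in> V \<and> y \<in> V \<and> word_adj x y}"
  by (simp add: universal_cover_def word_adj_def)

lemma verts_T: "verts T = V" and tail_T: "tail T = fst" and head_T: "head T = snd"
  by (simp_all add: universal_cover_def)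

text \<open>The vertex set is closed under prefixes, so the step that continues along
  \<open>x\<close> or deletes the last letter stays in the cover.\<close>

lemma ex_closer:
  assumes "x \<in> V" "y \<in> V" "x \<noteq> y"
  shows "\<exists>z\<in>V. word_adj y z \<and> word_dist x y = Suc (word_dist x z)"
proof (cases "prefix y x")
  case True
  then obtain s where s: "x = y @ s" by (auto simp: prefix_def)
  with assms(3) obtain a t where "s = a # t" by (cases s) auto
  with s have "prefix (y @ [a]) x" "x = (y @ [a]) @ t" by auto
  then show ?thesis
    using word_dist_closer_iff[of y "y @ [a]" x] prefix_in_V[of "y @ [a]" t] assms(1) by auto
next
  case False
  then obtain z a where "y = z @ [a]" by (cases y rule: rev_cases) auto
  then show ?thesis
    using word_dist_closer_iff[of y z x] prefix_in_V[of z "[a]"] assms(2) False by auto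
qed

text \<open>Each arc changes the word distance by one, so no walk is shorter than it.\<close>

lemma word_dist_le_length:
  "pre_digraph.cas T x p y \<Longrightarrow> set p \<subseteq> arcs T \<Longrightarrow> word_dist x y \<le> length p"
proof (induction p arbitrary: x)
  case Nil
  then show ?case by (simp add: pre_digraph.cas.simps)
next
  case (Cons e p)
  obtain z where e: "e = (x, z)" "word_adj x z"
    using Cons.prems by (cases e) (auto simp: pre_digraph.cas.simps tail_T arcs_T)
  have "word_dist z y \<le> length p"
    using Cons.prems by (intro Cons.IH) (auto simp: pre_digraph.cas.simps head_T e)
  then show ?case
    using word_dist_adj[OF e(2), of y] by (auto simp: word_dist_commute[of _ y])
qed

text \<open>Repeatedly moving to a neighbour nearer to \<open>y\<close> gives a walk of the minimal
  length.\<close>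

lemma ex_awalk_word_dist:
  "x \<in> V \<Longrightarrow> y \<in> V \<Longrightarrow> \<exists>p. pre_digraph.awalk T x p y \<and> length p = word_dist x y"
proof (induction "word_dist x y" arbitrary: x)
  case 0
  then show ?case
    by (intro exI[of _ "[]"]) (auto simp: pre_digraph.awalk_def pre_digraph.cas.simps verts_T)
next
  case (Suc n)
  then have "y \<noteq> x" by (metis word_dist_refl nat.distinct(1))
  then obtain z where z: "z \<in> V" "word_adj x z" "word_dist y x = Suc (word_dist y z)"
    using ex_closer[of y x] Suc.prems by auto
  with Suc.hyps(2) have "n = word_dist z y" by (simp add: word_dist_commute)
  from Suc.hyps(1)[OF this z(1) Suc.prems(2)]
  obtain p where "pre_digraph.awalk T z p y" "length p = word_dist z y" by blast
  then show ?case
    using z Suc.prems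
    by (intro exI[of _ "(x, z) # p"])
      (auto simp: pre_digraph.awalk_def pre_digraph.cas.simps verts_T tail_T head_T arcs_T
        word_dist_commute)
qed

lemma graph_dist_T:
  assumes "x \<in> V" "y \<in> V"
  shows "graph_dist T x y = word_dist x y"
  unfolding graph_dist_def
  using ex_awalk_word_dist[OF assms] word_dist_le_length
  by (intro Least_equality) (auto simp: pre_digraph.awalk_def)

section \<open>Geodesics and Busemann functions\<close>

context
  fixes \<gamma> :: "int \<Rightarrow> 'b list"
  assumes geod: "geodesic T \<gamma>"
begin

lemma geodesic_in_V: "\<gamma> i \<in> V"
  and geodesic_adj: "word_adj (\<gamma> i) (\<gamma> (i + 1))"
  and geodesic_neq: "\<gamma> i \<noteq> \<gamma> (i + 2)"
  using geod by (auto simp: geodesic_def verts_T arcs_ends_T)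

lemma word_dist_geodesic_away:
  assumes "word_dist w (\<gamma> (i + 1)) = Suc (word_dist w (\<gamma> i))"
  shows "word_dist w (\<gamma> (i + int n)) = word_dist w (\<gamma> i) + n"
proof -
  have "word_dist w (\<gamma> (i + int n + 1)) = Suc (word_dist w (\<gamma> (i + int n)))" for n
  proof (induction n)
    case 0 show ?case using assms by simp
  next
    case (Suc n)
    show ?case
      using word_dist_away[OF geodesic_adj[of "i + int n"] geodesic_adj[of "i + int n + 1"] _ Suc]
        geodesic_neq[of "i + int n"]
      by (simp add: add_ac)
  qed
  note step = this
  show ?thesis
  proof (induction n)
    case (Suc n) then show ?case using step[of n] by (simp add: add_ac)
  qed simp
qed

text \<open>Once the geodesic moves away from \<open>w\<close>, each step adds one to the distance,
  so the sequence in the limit is constant from \<open>m\<close> on.\<close>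

lemma busemann_eq:
  assumes "w \<in> V" and away: "word_dist w (\<gamma> (int m + 1)) = Suc (word_dist w (\<gamma> (int m)))"
  shows "busemann T \<gamma> 0 w = real (word_dist w (\<gamma> (int m))) - real m"
proof -
  have "real (graph_dist T w (\<gamma> (0 + int n))) - real n = real (word_dist w (\<gamma> (int m))) - real m"
    if n: "n \<ge> m" for n
  proof -
    obtain k where "n = m + k" using n le_Suc_ex by blast
    then show ?thesis
      using word_dist_geodesic_away[OF away, of k] assms(1) by (simp add: graph_dist_T geodesic_in_V)
  qed
  then have "(\<lambda>n. real (graph_dist T w (\<gamma> (0 + int n))) - real n)
      \<longlonglongrightarrow> real (word_dist w (\<gamma> (int m))) - real m"
    by (intro tendsto_eventually) (auto simp: eventually_at_top_linorder)
  then show ?thesis unfolding busemann_def by (rule limI)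
qed

text \<open>Otherwise the distance, a natural number, would decrease by one at every step from
  \<open>k\<close> on.\<close>

lemma ex_away:
  "\<exists>m\<ge>k. word_dist w (\<gamma> (int m + 1)) = Suc (word_dist w (\<gamma> (int m)))"
proof (rule ccontr)
  assume neg: "\<not> ?thesis"
  have "word_dist w (\<gamma> (int k)) = word_dist w (\<gamma> (int k + int n)) + n" for n
  proof (induction n)
    case (Suc n)
    have "word_dist w (\<gamma> (int (k + n))) = Suc (word_dist w (\<gamma> (int (k + n) + 1)))"
      using word_dist_adj[OF geodesic_adj[of "int (k + n)"], of w] neg by (meson le_add1)
    then show ?case using Suc by (simp add: add_ac)
  qed simp
  from this[of "Suc (word_dist w (\<gamma> (int k)))"] show False by simp
qed

lemma word_dist_geodesic_le: "word_dist w (\<gamma> (i + int n)) \<le> word_dist w (\<gamma> i) + n"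
proof (induction n)
  case (Suc n)
  then show ?case using word_dist_adj[OF geodesic_adj[of "i + int n"], of w] by (auto simp: add_ac)
qed simp

end

section \<open>Horocycle parts as cones, and the covering property\<close>

text \<open>For adjacent \<open>x\<close> and \<open>y\<close>, these are the endpoints of the
  non-backtracking paths of length \<open>r\<close> that continue the edge from \<open>x\<close> to
  \<open>y\<close>.\<close>

definition cone :: "nat \<Rightarrow> 'b list \<Rightarrow> 'b list \<Rightarrow> 'b list set" where
  "cone r x y = {w \<in> V. word_dist w y = r \<and> word_dist w x = Suc r}"

text \<open>For \<open>w\<close> at distance \<open>r\<close> from \<open>\<gamma> r\<close>, the
  Busemann value is \<open>r - r = 0\<close> if the geodesic moves away from \<open>w\<close> there,
  and negative if it still approaches \<open>w\<close>.\<close>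

lemma horocycle_part_eq_cone:
  assumes "geodesic T \<gamma>"
  shows "horocycle_part T \<gamma> r = cone r (\<gamma> (int r + 1)) (\<gamma> (int r))"
proof (intro set_eqI iffI)
  fix w assume "w \<in> cone r (\<gamma> (int r + 1)) (\<gamma> (int r))"
  then show "w \<in> horocycle_part T \<gamma> r"
    using busemann_eq[OF assms, of w r]
    by (simp add: cone_def horocycle_part_def horocycle_def graph_sphere_def verts_T graph_dist_T
        geodesic_in_V[OF assms])
next
  fix w assume "w \<in> horocycle_part T \<gamma> r"
  then have w: "w \<in> V" "word_dist w (\<gamma> (int r)) = r" "busemann T \<gamma> 0 w = 0"
    by (auto simp: horocycle_part_def horocycle_def graph_sphere_def verts_T graph_dist_T
        geodesic_in_V[OF assms])
  have "word_dist w (\<gamma> (int r + 1)) = Suc r"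
  proof (rule ccontr)
    assume "\<not> ?thesis"
    then have less: "Suc (word_dist w (\<gamma> (int r + 1))) = r"
      using word_dist_adj[OF geodesic_adj[OF assms, of "int r"], of w] w(2) by auto
    \<comment> \<open>Busemann value 0 makes the distance to \<open>\<gamma> m\<close> equal to
      \<open>m\<close>, whereas the path through \<open>\<gamma> (r + 1)\<close> bounds it by
      \<open>m - 2\<close>.\<close>
    obtain m where m: "m \<ge> Suc r" "word_dist w (\<gamma> (int m + 1)) = Suc (word_dist w (\<gamma> (int m)))"
      using ex_away[OF assms] by blast
    obtain n where n: "m = Suc r + n" using m(1) le_Suc_ex by blast
    have "word_dist w (\<gamma> (int m)) = m"
      using busemann_eq[OF assms w(1) m(2)] w(3) by simp
    moreover have "word_dist w (\<gamma> (int m)) \<le> word_dist w (\<gamma> (int r + 1)) + n"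
      using word_dist_geodesic_le[OF assms, of w "int r + 1" n] by (simp add: n add_ac)
    ultimately show False using less n by simp
  qed
  then show "w \<in> cone r (\<gamma> (int r + 1)) (\<gamma> (int r))"
    using w by (simp add: cone_def)
qed

definition nbrs :: "'b list \<Rightarrow> 'b list set" where
  "nbrs y = {z \<in> V. word_adj y z}"

text \<open>The arc of \<open>G\<close> below the step between adjacent words: appending a letter
  traverses it, deleting it traverses its inverse.\<close>

definition arc_of :: "'b list \<Rightarrow> 'b list \<Rightarrow> 'b" where
  "arc_of x y = (if length x < length y then last y else arev (last x))"

lemma arc_of_snoc [simp]: "arc_of x (x @ [a]) = a" "arc_of (x @ [a]) x = arev a"
  by (simp_all add: arc_of_def)

lemma arc_of_commute:
  assumes "word_adj x y"
  shows "arc_of y x = arev (arc_of x y)"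
  using assms by (auto simp: word_adj_def)

text \<open>The covering property. The parent of \<open>y\<close> accounts for the reverse of the
  last letter of \<open>y\<close>, the children for all other arcs.\<close>

lemma bij_betw_arc_of:
  assumes "y \<in> V"
  shows "bij_betw (arc_of y) (nbrs y) (out_arcs G (proj y))"
  unfolding bij_betw_def
proof
  show "inj_on (arc_of y) (nbrs y)"
  proof -
    \<comment> \<open>Non-backtracking keeps a child from sharing its arc with the parent.\<close>
    have "z @ [a, arev a] \<notin> V" "[a, arev a] \<notin> V" for z a
      using snoc_in_V_iff[of "z @ [a]" "arev a"] snoc_in_V_iff[of "[a]" "arev a"] by auto
    then show ?thesis
      using assms by (auto simp: inj_on_def nbrs_def word_adj_def snoc_in_V_iff arc_of_def)
  qed
  show "arc_of y ` nbrs y = out_arcs G (proj y)"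
  proof (intro set_eqI iffI)
    fix e assume "e \<in> arc_of y ` nbrs y"
    then show "e \<in> out_arcs G (proj y)"
      using assms by (auto simp: nbrs_def word_adj_def snoc_in_V_iff proj_snoc)
  next
    fix e assume e: "e \<in> out_arcs G (proj y)"
    show "e \<in> arc_of y ` nbrs y"
    proof (cases "y \<noteq> [] \<and> e = arev (last y)")
      case True
      then obtain z a where "y = z @ [a]" by (cases y rule: rev_cases) auto
      then show ?thesis
        using True assms by (intro image_eqI[of _ _ z]) (auto simp: nbrs_def word_adj_def snoc_in_V_iff)
    next
      case False
      then show ?thesis
        using e assms
        by (intro image_eqI[of _ _ "y @ [e]"]) (auto simp: nbrs_def word_adj_def snoc_in_V_iff)
    qed
  qed
qed

lemma arc_of_in_arcs:
  assumes "x \<in> V" "y \<in> V" "word_adj x y"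
  shows "arc_of x y \<in> arcs G" and "head G (arc_of x y) = proj y"
proof -
  have "arc_of x y \<in> out_arcs G (proj x)" "arc_of y x \<in> out_arcs G (proj y)"
    using bij_betwE[OF bij_betw_arc_of] assms by (auto simp: nbrs_def word_adj_commute)
  then show "arc_of x y \<in> arcs G" "head G (arc_of x y) = proj y"
    using arc_of_commute[OF assms(3)] by auto
qed

lemma cone_0:
  assumes "x \<in> V" "y \<in> V" "word_adj x y"
  shows "cone 0 x y = {y}"
  using word_dist_adj[OF assms(3), of y] assms by (auto simp: cone_def)

text \<open>A vertex \<open>w\<close> of the cone lies beyond the neighbour \<open>z\<close> of
  \<open>y\<close> nearer to it, and \<open>z\<close> is not \<open>x\<close>, which is farther from
  \<open>w\<close>. Conversely, the path from \<open>w\<close> through \<open>z\<close> and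
  \<open>y\<close> to \<open>x\<close> keeps moving away.\<close>

lemma cone_Suc:
  assumes "word_adj x y" "x \<in> V" "y \<in> V"
  shows "cone (Suc r) x y = (\<Union>z\<in>nbrs y - {x}. cone r y z)"
proof (intro set_eqI iffI)
  fix w assume "w \<in> cone (Suc r) x y"
  then have w: "w \<in> V" "word_dist w y = Suc r" "word_dist w x = Suc (Suc r)"
    by (auto simp: cone_def)
  then have "w \<noteq> y" by auto
  then obtain z where "z \<in> V" "word_adj y z" "word_dist w y = Suc (word_dist w z)"
    using ex_closer[of w y] assms(3) w by blast
  then show "w \<in> (\<Union>z\<in>nbrs y - {x}. cone r y z)"
    using w by (auto simp: cone_def nbrs_def)
next
  fix w assume "w \<in> (\<Union>z\<in>nbrs y - {x}. cone r y z)"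
  then obtain z where z: "word_adj y z" "z \<noteq> x" "w \<in> V" "word_dist w z = r" "word_dist w y = Suc r"
    by (auto simp: cone_def nbrs_def)
  then have "word_dist w x = Suc (Suc r)"
    using word_dist_away[of z y x w] assms(1) by (simp add: word_adj_commute)
  then show "w \<in> cone (Suc r) x y" using z by (simp add: cone_def)
qed

lemma disjoint_cones:
  assumes "z \<in> nbrs y" "z' \<in> nbrs y" "z \<noteq> z'"
  shows "cone r y z \<inter> cone r y z' = {}"
  using assms word_dist_closer_unique[of y z _ z'] by (auto simp: cone_def nbrs_def)

end

section \<open>Horocycle averages\<close>

locale rooted_regular_graph = regular_nonbipartite_graph G arev q + rooted_bidirected_digraph G arev rt
  for G :: "('a, 'b) pre_digraph" and arev :: "'b \<Rightarrow> 'b" and q :: nat and rt :: 'a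
begin

lemma finite_nbrs: "y \<in> V \<Longrightarrow> finite (nbrs y)"
  using bij_betw_finite[OF bij_betw_arc_of] finite_out_arcs by blast

text \<open>Each level of the cone recursion is one application of \<open>nbt\<close>, and its
  factor \<open>q\<close> undoes the averaging. Finiteness is carried along because splitting the
  sum over the subcones requires it.\<close>

lemma sum_cone:
  fixes h :: "'a \<Rightarrow> real"
  assumes "x \<in> V" "y \<in> V" "word_adj x y"
  shows "finite (cone r x y) \<and>
    (\<Sum>w\<in>cone r x y. h (proj w)) = real q ^ r * (nbt ^^ r) (\<lambda>a. h (head G a)) (arc_of x y)"
  using assms
proof (induction r arbitrary: x y)
  case 0
  then show ?case by (simp add: cone_0 arc_of_in_arcs)
next
  case (Suc r)
  define F where "F = (nbt ^^ r) (\<lambda>a. h (head G a))"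
  have nb: "z \<in> V" "word_adj y z" if "z \<in> nbrs y - {x}" for z
    using that by (auto simp: nbrs_def)
  note IH = Suc.IH[OF Suc.prems(2) nb, folded F_def]
  have fin: "finite (nbrs y - {x})" using finite_nbrs Suc.prems(2) by blast
  have x: "x \<in> nbrs y" using Suc.prems by (simp add: nbrs_def word_adj_commute)
  \<comment> \<open>The neighbour \<open>x\<close> lies over the inverse of
    \<open>arc_of x y\<close>, so leaving it out matches the arc left out by
    \<open>nbt\<close>.\<close>
  have bij: "bij_betw (arc_of y) (nbrs y - {x})
      (out_arcs G (head G (arc_of x y)) - {arev (arc_of x y)})"
    using bij_betw_arc_of[OF Suc.prems(2)] x
      inj_on_image_set_diff[of "arc_of y" "nbrs y" "nbrs y" "{x}"]
    by (simp add: bij_betw_def inj_on_diff arc_of_in_arcs(2)[OF Suc.prems]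
        arc_of_commute[OF Suc.prems(3)])
  have "(\<Sum>w\<in>cone (Suc r) x y. h (proj w)) = (\<Sum>z\<in>nbrs y - {x}. \<Sum>w\<in>cone r y z. h (proj w))"
    unfolding cone_Suc[OF Suc.prems(3,1,2)]
    using fin IH disjoint_cones by (intro sum.UNION_disjoint) auto
  also have "\<dots> = (\<Sum>z\<in>nbrs y - {x}. real q ^ r * F (arc_of y z))"
    using IH by (intro sum.cong) auto
  also have "\<dots> = real q ^ r * (\<Sum>z\<in>nbrs y - {x}. F (arc_of y z))"
    by (simp add: sum_distrib_left)
  also have "(\<Sum>z\<in>nbrs y - {x}. F (arc_of y z))
      = (\<Sum>a\<in>out_arcs G (head G (arc_of x y)) - {arev (arc_of x y)}. F a)"
    by (rule sum.reindex_bij_betw[OF bij])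
  also have "\<dots> = real q * nbt F (arc_of x y)"
    using q_ge_2 by (simp add: nbt_def)
  finally show ?case
    using fin IH cone_Suc[OF Suc.prems(3,1,2)] by (simp add: F_def)
qed

text \<open>The cone sum of the constant 1, which \<open>nbt\<close> preserves on arcs.\<close>

lemma card_cone:
  assumes "x \<in> V" "y \<in> V" "word_adj x y"
  shows "real (card (cone r x y)) = real q ^ r"
proof -
  have "(nbt ^^ r) (\<lambda>_. 1) a = 1" if "a \<in> arcs G" for a
    using that
  proof (induction r arbitrary: a)
    case (Suc r)
    have "arev a \<in> out_arcs G (head G a)" "head G a \<in> verts G" using Suc.prems by auto
    moreover have "(\<Sum>b\<in>out_arcs G (head G a) - {arev a}. (nbt ^^ r) (\<lambda>_. 1) b)
        = (\<Sum>b\<in>out_arcs G (head G a) - {arev a}. 1)"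
      by (rule sum.cong) (auto simp: Suc.IH)
    ultimately show ?case
      using q_ge_2 by (simp add: nbt_def[of "(nbt ^^ r) _"] card_out_arcs)
  qed simp
  then show ?thesis
    using sum_cone[OF assms, of r "\<lambda>_. 1"] arc_of_in_arcs(1)[OF assms] by simp
qed

text \<open>The deviation from the mean is the value of an iterate of \<open>nbt\<close> at one arc,
  and the norm of the iterate bounds it.\<close>

lemma horocycle_average:
  fixes f :: "'a \<Rightarrow> real"
  assumes geod: "geodesic T \<gamma>"
    and \<beta>: "0 < \<beta>" "\<beta> \<le> 1" "M \<le> \<beta> ^ 4"
    and M: "\<And>g. (\<Sum>a\<in>arcs G. g a) = 0 \<Longrightarrow> energy (nbt (nbt g)) \<le> M * energy g"
  shows "\<bar>(\<Sum>x\<in>horocycle_part T \<gamma> r. lift G rt f x) / real (card (horocycle_part T \<gamma> r))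
      - (\<Sum>v\<in>verts G. f v) / real (card (verts G))\<bar>
    \<le> sqrt (real q + 1) / \<beta> * L2_set f (verts G) * \<beta> ^ r"
proof -
  define x y where "x = \<gamma> (int r + 1)" and "y = \<gamma> (int r)"
  have xy: "x \<in> V" "y \<in> V" "word_adj x y"
    using geodesic_in_V[OF geod] geodesic_adj[OF geod, of "int r"]
    by (auto simp: x_def y_def word_adj_commute)
  define c where "c = (\<Sum>v\<in>verts G. f v) / real (card (verts G))"
  \<comment> \<open>Each vertex is the head of \<open>q + 1\<close> arcs, so subtracting the vertex
    mean gives sum zero over the arcs.\<close>
  define g where "g a = f (head G a) - c" for a
  have "card (verts G) \<noteq> 0" using root_in_verts by auto
  then have "(\<Sum>a\<in>arcs G. g a) = 0"
    unfolding g_def using sum_arcs_head[of "\<lambda>v. f v - c"] by (simp add: sum_subtractf c_def)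
  note decay = energy_nbt_decay[OF \<beta> M this, of r]
  have "(\<Sum>w\<in>cone r x y. f (proj w) - c) = real q ^ r * (nbt ^^ r) g (arc_of x y)"
    using sum_cone[OF xy, of r "\<lambda>v. f v - c"] by (simp add: g_def[abs_def])
  then have "(\<Sum>w\<in>cone r x y. lift G rt f w) / real (card (cone r x y)) - c = (nbt ^^ r) g (arc_of x y)"
    using q_ge_2 by (simp add: card_cone[OF xy] sum_subtractf lift_def diff_divide_distrib field_simps)
  moreover have "\<bar>(nbt ^^ r) g (arc_of x y)\<bar> \<le> sqrt (real q + 1) / \<beta> * L2_set f (verts G) * \<beta> ^ r"
  proof (rule power2_le_imp_le)
    have "((nbt ^^ r) g (arc_of x y))\<^sup>2 \<le> energy ((nbt ^^ r) g)"
      unfolding energy_def using arc_of_in_arcs(1)[OF xy] by (intro member_le_sum) auto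
    also have "\<dots> \<le> energy g / \<beta>\<^sup>2 * (\<beta> ^ r)\<^sup>2" by (rule decay)
    \<comment> \<open>The same count of arcs is the source of the factor
      \<open>sqrt (real q + 1)\<close>.\<close>
    also have "energy g = (real q + 1) * (\<Sum>v\<in>verts G. (f v - c)\<^sup>2)"
      unfolding energy_def g_def by (rule sum_arcs_head)
    also have "(real q + 1) * (\<Sum>v\<in>verts G. (f v - c)\<^sup>2) / \<beta>\<^sup>2 * (\<beta> ^ r)\<^sup>2
        \<le> (real q + 1) * (\<Sum>v\<in>verts G. (f v)\<^sup>2) / \<beta>\<^sup>2 * (\<beta> ^ r)\<^sup>2"
      unfolding c_def
      by (intro mult_right_mono divide_right_mono mult_left_mono sum_power2_diff_mean_le) auto
    also have "\<dots> = (sqrt (real q + 1) / \<beta> * L2_set f (verts G) * \<beta> ^ r)\<^sup>2"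
      by (simp add: power_mult_distrib power_divide L2_set_def sum_nonneg)
    finally show "\<bar>(nbt ^^ r) g (arc_of x y)\<bar>\<^sup>2 \<le> \<dots>" by simp
  qed (use \<beta> in simp)
  ultimately show ?thesis
    unfolding horocycle_part_eq_cone[OF geod] c_def[symmetric] x_def[symmetric] y_def[symmetric]
    by simp
qed

end

theorem theorem4:
  fixes G :: "('a, 'b) pre_digraph" and arev :: "'b \<Rightarrow> 'b" and q :: nat
  assumes "bidirected_digraph G arev"
    and "fin_digraph G"
    and "Digraph_Component.connected G"
    and "\<not> bipartite G"
    and "q + 1 \<ge> 3"
    and "\<forall>v\<in>verts G. out_degree G v = q + 1"
  shows "\<exists>C \<beta> :: real. C > 0 \<and> real q powr (- 1 / 2) \<le> \<beta> \<and> \<beta> < 1 \<and>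
    (\<forall>rt\<in>verts G. \<forall>f :: 'a \<Rightarrow> real. \<forall>\<gamma>. \<forall>r :: nat.
      geodesic (universal_cover G arev rt) \<gamma> \<longrightarrow>
      \<bar>(\<Sum>x\<in>horocycle_part (universal_cover G arev rt) \<gamma> r. lift G rt f x)
           / real (card (horocycle_part (universal_cover G arev rt) \<gamma> r))
         - (\<Sum>v\<in>verts G. f v) / real (card (verts G))\<bar>
      \<le> C * L2_set f (verts G) * \<beta> ^ r)"
proof -
  interpret bidirected_digraph G arev by fact
  interpret fin_digraph G by fact
  interpret regular_nonbipartite_graph G arev q
    using assms by unfold_locales auto
  obtain M where M: "0 \<le> M" "M < 1"
      "\<And>g. (\<Sum>a\<in>arcs G. g a) = 0 \<Longrightarrow> energy (nbt (nbt g)) \<le> M * energy g"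
    using energy_contraction by blast
  \<comment> \<open>\<open>M\<close> bounds a squared norm over two steps, hence the fourth root.
    The maximum enforces the required lower bound and keeps \<beta> positive if \<open>M\<close> is
    0. All constants are fixed before the root, \<open>f\<close> and \<gamma> are chosen.\<close>
  define \<beta> where "\<beta> = max (root 4 M) (real q powr (- 1 / 2))"
  have q: "1 < real q" using q_ge_2 by simp
  have \<beta>: "0 < \<beta>" "\<beta> < 1" "real q powr (- 1 / 2) \<le> \<beta>"
    using q M(1,2) powr_less_mono[of "- 1 / 2" 0 "real q"] by (auto simp: \<beta>_def less_max_iff_disj)
  have "M = root 4 M ^ 4" using M(1) by simp
  also have "\<dots> \<le> \<beta> ^ 4" using M(1) by (intro power_mono) (auto simp: \<beta>_def)
  finally have M\<beta>: "M \<le> \<beta> ^ 4" .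
  have "\<bar>(\<Sum>x\<in>horocycle_part (universal_cover G arev rt) \<gamma> r. lift G rt f x)
           / real (card (horocycle_part (universal_cover G arev rt) \<gamma> r))
         - (\<Sum>v\<in>verts G. f v) / real (card (verts G))\<bar>
      \<le> sqrt (real q + 1) / \<beta> * L2_set f (verts G) * \<beta> ^ r"
    if "rt \<in> verts G" "geodesic (universal_cover G arev rt) \<gamma>" for rt \<gamma> r and f :: "'a \<Rightarrow> real"
  proof -
    interpret rooted_regular_graph G arev q rt
      using that(1) by unfold_locales
    show ?thesis using horocycle_average[OF that(2) \<beta>(1) _ M\<beta> M(3)] \<beta>(2) by simp
  qed
  then show ?thesis
    using \<beta> by (intro exI[of _ "sqrt (real q + 1) / \<beta>"] exI[of _ \<beta>]) auto
qed

end
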